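(* Let $\tau,\tau_r$ be types (sets), let $f:\tau_r\times\tau\to\tau_r$ (a right action of $\tau$ on $\tau_r$), let $\mathcal I\in\tau_r$, and let $\mathcal P=\lambda x.\ \mathsf{aggregate}(f,\mathcal I,x)$ be the corresponding aggregation program on dataframes with rows of type $\tau$. Let $h:\tau_r\times\tau_r\to\tau_r$ be a normalizer of $f$ satisfying $h(s,\mathcal I)=s$ for all $s\in\tau_r$. Then $\mathcal P$ is a dataframe homomorphism.
   Context: A dataframe of type $\mathsf{DF}\langle\tau\rangle$ is, for fixed column labels and column types, a finite (possibly empty) list of rows $[r_1,\dots,r_n]$, each row being an element of $\tau$ (the type of a row). For dataframes $\mathcal D_1,\mathcal D_2$ with the same columns and column types, $\mathcal D_1\boxplus\mathcal D_2$ is the dataframe whose list of rows is the rows of $\mathcal D_1$ followed by the rows of $\mathcal D_2$. For $f:\tau_r\times\tau\to\tau_r$ and $\mathcal I\in\tau_r$, $\mathsf{aggregate}(f,\mathcal I,[r_1,\dots,r_n])=f(\dots f(f(\mathcal I,r_1),r_2)\dots,r_n)$ (left fold); on the empty dataframe it equals $\mathcal I$. A function $\mathcal P$ from dataframes to $\tau_r$ is a dataframe homomorphism if there exists a function $\oplus:\tau_r\times\tau_r\to\tau_r$ (a merge operator) such that $\mathcal P(\mathcal D_1\boxplus\mathcal D_2)=\mathcal P(\mathcal D_1)\oplus\mathcal P(\mathcal D_2)$ for all dataframes $\mathcal D_1,\mathcal D_2$ on which $\boxplus$ is defined. A right action of a set $X$ on a set $Y$ is any function $Y\times X\to Y$;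 a left action of $X$ on $Y$ is any function $X\times Y\to Y$. A normalizer of a right action $f:\tau_r\times\tau\to\tau_r$ is a left action $h:\tau_r\times\tau_r\to\tau_r$ of $\tau_r$ on itself that commutes with $f$: $h(z,f(y,x))=f(h(z,y),x)$ for all $x\in\tau$ and $y,z\in\tau_r$. *)

theory Defs
  imports Main
begin

text \<open>
  The column labels and column types are fixed throughout, so a dataframe is determined by its
  list of rows, and the type of a row is the type parameter. Two dataframes can be concatenated
  precisely when they have the same row type, so \<open>\<boxplus>\<close> is total on each type.
\<close>

type_synonym 'a dataframe = "'a list"

definition df_concat :: "'a dataframe \<Rightarrow> 'a dataframe \<Rightarrow> 'a dataframe" (infixl "\<boxplus>" 65) where
  "D1 \<boxplus> D2 = D1 @ D2"

definition aggregate :: "('r \<Rightarrow> 'a \<Rightarrow> 'r) \<Rightarrow> 'r \<Rightarrow> 'a dataframe \<Rightarrow> 'r" where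
  "aggregate f I D = foldl f I D"

definition dataframe_homomorphism :: "('a dataframe \<Rightarrow> 'r) \<Rightarrow> bool" where
  "dataframe_homomorphism P \<longleftrightarrow>
     (\<exists>merge :: 'r \<Rightarrow> 'r \<Rightarrow> 'r. \<forall>D1 D2. P (D1 \<boxplus> D2) = merge (P D1) (P D2))"

text \<open>
  Actions carry no laws: a right action of \<open>'a\<close> on \<open>'r\<close> is an arbitrary function
  \<open>'r \<Rightarrow> 'a \<Rightarrow> 'r\<close>, and a left action of \<open>'r\<close> on itself an arbitrary function
  \<open>'r \<Rightarrow> 'r \<Rightarrow> 'r\<close>.
\<close>

definition normalizer :: "('r \<Rightarrow> 'a \<Rightarrow> 'r) \<Rightarrow> ('r \<Rightarrow> 'r \<Rightarrow> 'r) \<Rightarrow> bool" where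
  "normalizer f h \<longleftrightarrow> (\<forall>x y z. h z (f y x) = f (h z y) x)"

end

theory Submission
  imports Defs
begin

text \<open>The normalizer \<open>h\<close> is itself the merge operator. Since \<open>h z\<close>
  commutes with each step of \<open>f\<close>, it passes through a whole fold to the initial value;
  there \<open>h z I = z\<close>, so merging with \<open>z\<close> resumes the second fold from the
  result \<open>z\<close> of the first.\<close>

lemma normalizer_foldl:
  assumes "normalizer f h"
  shows "h z (foldl f y D) = foldl f (h z y) D"
  using assms by (induction D arbitrary: y) (simp_all add: normalizer_def)

theorem theorem4p8:
  fixes f :: "'r \<Rightarrow> 'a \<Rightarrow> 'r"
    and I :: 'r
    and h :: "'r \<Rightarrow> 'r \<Rightarrow> 'r"
  assumes "normalizer f h"
    and "\<And>s. h s I = s"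
  shows "dataframe_homomorphism (\<lambda>x. aggregate f I x)"
  unfolding dataframe_homomorphism_def
proof (intro exI allI)
  fix D1 D2 :: "'a dataframe"
  \<comment> \<open>This instantiates the schematic merge operator left by \<open>exI\<close> with
    \<open>h\<close>, which depends on neither \<open>D1\<close> nor \<open>D2\<close>.\<close>
  show "aggregate f I (D1 \<boxplus> D2) = h (aggregate f I D1) (aggregate f I D2)"
    using assms by (simp add: aggregate_def df_concat_def normalizer_foldl)
qed

end
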